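(* Let $A,B\in\mathbb{R}$ with $4A^3+27B^2\neq 0$ and let $E$ be the elliptic curve $y^2=x^3+Ax+B$. Let $P_n=(x_n,y_n)$, $n\ge 1$, be a sequence of affine points on the identity component of $E(\mathbb{R})$, and let $s_n\in(0,\omega)$ be the real uniformization parameter of $P_n$. If $(s_n)$ is equidistributed in $[0,\omega]$, then the sequence of fractional parts $(\{x_n\})$ is not equidistributed in $[0,1]$ with respect to the Lebesgue measure.
   Context: Let $e$ be the largest real root of $x^3+Ax+B$. The identity component of $E(\mathbb{R})$ consists of $O$ and the points with $x\ge e$. Let $\Lambda\subset\mathbb{C}$ be the lattice with invariants $g_2=-4A$, $g_3=-4B$, let $\wp$ be its Weierstrass function, and let $\omega>0$ be the smallest positive real element of $\Lambda$. The map $z\mapsto(\wp(z),\tfrac12\wp'(z))$ is a bijection from $(0,\omega)$ onto the affine points of the identity component; the uniformization parameter of such a point is its preimage in $(0,\omega)$. A sequence $(s_n)$ in $[a,b]$ is equidistributed in $[a,b]$ if $\lim_{N\to\infty}\frac1N\#\{n\le N: s_n\in[c,d]\}=\frac{d-c}{b-a}$ for every $[c,d]\subseteq[a,b]$. $\{x\}$ denotes the fractional part of $x$. *)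

theory Defs
  imports "HOL-Analysis.Analysis"
begin

definition complex_lattice :: "complex set \<Rightarrow> bool" where
  "complex_lattice \<Lambda> \<longleftrightarrow>
     (\<exists>w1 w2 :: complex. w1 \<noteq> w2 \<and> independent {w1, w2} \<and>
        \<Lambda> = {of_int m * w1 + of_int n * w2 | m n :: int. True})"

definition lattice_g2 :: "complex set \<Rightarrow> complex" where
  "lattice_g2 \<Lambda> = 60 * (\<Sum>\<^sub>\<infinity>w\<in>\<Lambda> - {0}. 1 / w ^ 4)"

definition lattice_g3 :: "complex set \<Rightarrow> complex" where
  "lattice_g3 \<Lambda> = 140 * (\<Sum>\<^sub>\<infinity>w\<in>\<Lambda> - {0}. 1 / w ^ 6)"

(* Meaningful for z outside the lattice; at its poles the value is a junk value. *)
definition weierstrass_p :: "complex set \<Rightarrow> complex \<Rightarrow> complex" where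
  "weierstrass_p \<Lambda> z = 1 / z ^ 2 + (\<Sum>\<^sub>\<infinity>w\<in>\<Lambda> - {0}. 1 / (z - w) ^ 2 - 1 / w ^ 2)"

definition least_positive_real_period :: "complex set \<Rightarrow> real \<Rightarrow> bool" where
  "least_positive_real_period \<Lambda> \<omega> \<longleftrightarrow>
     0 < \<omega> \<and> complex_of_real \<omega> \<in> \<Lambda> \<and>
     (\<forall>t::real. 0 < t \<and> complex_of_real t \<in> \<Lambda> \<longrightarrow> \<omega> \<le> t)"

(* Max ranges over the nonempty finite set of real roots of a cubic. *)
definition largest_real_root :: "real \<Rightarrow> real \<Rightarrow> real" where
  "largest_real_root A B = Max {x::real. x ^ 3 + A * x + B = 0}"

(* The identity component of the real points, without the point at infinity. *)
definition affine_identity_component :: "real \<Rightarrow> real \<Rightarrow> (real \<times> real) set" where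
  "affine_identity_component A B =
     {(x, y). y ^ 2 = x ^ 3 + A * x + B \<and> largest_real_root A B \<le> x}"

definition uniformization_parameter ::
    "complex set \<Rightarrow> real \<Rightarrow> real \<times> real \<Rightarrow> real \<Rightarrow> bool" where
  "uniformization_parameter \<Lambda> \<omega> P s \<longleftrightarrow>
     s \<in> {0<..<\<omega>} \<and>
     weierstrass_p \<Lambda> (of_real s) = of_real (fst P) \<and>
     deriv (weierstrass_p \<Lambda>) (of_real s) / 2 = of_real (snd P)"

(* Sequences are indexed from 1; the value at index 0 is ignored. *)
definition equidistributed_in :: "(nat \<Rightarrow> real) \<Rightarrow> real \<Rightarrow> real \<Rightarrow> bool" where
  "equidistributed_in s a b \<longleftrightarrow>
     (\<forall>n\<ge>1. s n \<in> {a..b}) \<and>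
     (\<forall>c d. a \<le> c \<and> c \<le> d \<and> d \<le> b \<longrightarrow>
        (\<lambda>N. real (card {n \<in> {1..N}. s n \<in> {c..d}}) / real N)
          \<longlonglongrightarrow> (d - c) / (b - a))"

end

theory Submission
  imports Defs
begin

text \<open>Evenness and periodicity make \<open>\<wp>\<close> symmetric about \<open>\<omega>/2\<close>, so that
  \<open>\<wp>(\<omega>/2 + h) - \<wp>(\<omega>/2)\<close> is half of a second difference and hence \<open>O(h\<^sup>2)\<close>. The parameters
  \<open>s n\<close> fall within \<open>h\<close> of \<open>\<omega>/2\<close> with frequency \<open>2h/\<omega>\<close>, and then the fractional part of
  \<open>x n = \<wp>(s n)\<close> lies in a set of measure \<open>O(h\<^sup>2)\<close>; for small \<open>h\<close> this contradicts
  equidistribution. The second difference is estimated termwise in the defining series,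
  using only the convergence of the sum of \<open>1 / \<bar>w\<bar>\<^sup>3\<close> over the lattice.\<close>

section \<open>Lattice sums\<close>

lemma summable_on_int_powr:
  "(\<lambda>n::int. (1 + \<bar>real_of_int n\<bar>) powr (-3/2)) summable_on UNIV"
proof -
  let ?f = "\<lambda>n::int. (1 + \<bar>real_of_int n\<bar>) powr (-3/2)"
  have "summable (\<lambda>n. real (Suc n) powr (-3/2))"
    using summable_real_powr_iff[of "-3/2"] by (subst summable_Suc_iff) simp
  then have nat: "(\<lambda>n. real (Suc n) powr (-3/2)) summable_on UNIV"
    by (intro summable_nonneg_imp_summable_on) auto
  have "?f summable_on range int"
    using nat by (subst summable_on_reindex) (auto simp: o_def add_ac)
  moreover have "?f summable_on range (\<lambda>n. - int n)"
    using nat by (subst summable_on_reindex) (auto simp: o_def inj_def add_ac)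
  ultimately have "?f summable_on (range int \<union> range (\<lambda>n. - int n))"
    by (rule summable_on_union)
  moreover have "range int \<union> range (\<lambda>n. - int n) = UNIV"
    by (auto simp: image_iff) (metis int_cases2)
  ultimately show ?thesis by simp
qed

text \<open>The double sum is a product of two convergent one-dimensional sums. The exponent 3/2 is
  half of the 3 needed for lattice points: each coordinate is dominated by the norm, so the product
  of the two factors is dominated by its square.\<close>

lemma summable_on_int_pair_powr:
  "(\<lambda>(m::int, n::int). ((1 + \<bar>real_of_int m\<bar>) * (1 + \<bar>real_of_int n\<bar>)) powr (-3/2)) summable_on UNIV"
proof -
  let ?f = "\<lambda>n::int. (1 + \<bar>real_of_int n\<bar>) powr (-3/2)"
  have "(\<lambda>(m, n). ?f m * ?f n) summable_on (UNIV \<times> UNIV)"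
  proof (rule summable_on_SigmaI)
    show "((\<lambda>n. case (m, n) of (m, n) \<Rightarrow> ?f m * ?f n) has_sum ?f m * infsum ?f UNIV) UNIV" for m
      using has_sum_cmult_right[OF has_sum_infsum[OF summable_on_int_powr]] by simp
    show "(\<lambda>m. ?f m * infsum ?f UNIV) summable_on UNIV"
      by (rule summable_on_cmult_left[OF summable_on_int_powr])
  qed auto
  then show ?thesis
    by (simp add: powr_mult)
qed

text \<open>Multiplying a lattice point by \<open>cnj w1\<close> or \<open>cnj w2\<close> and taking
  imaginary parts isolates one coordinate times the determinant \<open>D\<close>, which is nonzero
  because the generators are independent over the reals. Hence the norm controls both
  coordinates.\<close>

lemma complex_lattice_coordinates:
  assumes "complex_lattice \<Lambda>"
  obtains w1 w2 K where "K > 0" "\<Lambda> = {of_int m * w1 + of_int n * w2 | m n :: int. True}"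
    "\<And>m n. of_int m * w1 + of_int n * w2 \<noteq> 0 \<Longrightarrow>
       1 + \<bar>real_of_int m\<bar> \<le> K * norm (of_int m * w1 + of_int n * w2) \<and>
       1 + \<bar>real_of_int n\<bar> \<le> K * norm (of_int m * w1 + of_int n * w2)"
proof -
  obtain w1 w2 where ne: "w1 \<noteq> w2" and ind: "independent {w1, w2}"
    and L: "\<Lambda> = {of_int m * w1 + of_int n * w2 | m n :: int. True}"
    using assms unfolding complex_lattice_def by blast
  define D where "D = Im (cnj w1 * w2)"
  have w2: "w2 \<noteq> 0"
    using ind dependent_zero by blast
  have "w1 \<notin> span {w2}"
    using ind ne by (auto simp: dependent_def insert_Diff_if)
  then have nspan: "w1 \<noteq> k *\<^sub>R w2" for k
    by (auto simp: span_singleton)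
  have D: "D \<noteq> 0"
  proof
    \<comment> \<open>If \<open>D\<close> vanishes, \<open>cnj w1 * w2\<close> is real, and
      multiplying its conjugate by \<open>w2\<close> exhibits \<open>w1\<close> as a real multiple
      of \<open>w2\<close>.\<close>
    assume "D = 0"
    then have "cnj w1 * w2 = of_real (Re (cnj w1 * w2))"
      by (simp add: D_def complex_eq_iff)
    then have "w1 * cnj w2 = of_real (Re (cnj w1 * w2))"
      by (metis complex_cnj_cnj complex_cnj_complex_of_real complex_cnj_mult)
    then have "w1 * (cnj w2 * w2) = of_real (Re (cnj w1 * w2)) * w2"
      by (simp add: mult.assoc[symmetric])
    moreover have "cnj w2 * w2 = of_real ((norm w2)\<^sup>2)"
      by (metis complex_norm_square mult.commute)
    ultimately have "w1 = (Re (cnj w1 * w2) / (norm w2)\<^sup>2) *\<^sub>R w2"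
      using w2 by (simp add: scaleR_conv_of_real field_simps)
    with nspan show False by blast
  qed
  define M where "M = (norm w1 + norm w2) / \<bar>D\<bar>"
  have M: "M > 0"
    using w2 D by (simp add: M_def add_nonneg_pos)
  have bound: "\<bar>real_of_int m\<bar> \<le> M * norm (of_int m * w1 + of_int n * w2) \<and>
       \<bar>real_of_int n\<bar> \<le> M * norm (of_int m * w1 + of_int n * w2)" for m n
  proof -
    define z where "z = of_int m * w1 + of_int n * w2"
    have "Im (cnj w1 * z) = of_int n * D" "Im (cnj w2 * z) = - of_int m * D"
      by (simp_all add: z_def D_def algebra_simps)
    then have "\<bar>of_int n\<bar> * \<bar>D\<bar> \<le> norm (cnj w1 * z)" "\<bar>of_int m\<bar> * \<bar>D\<bar> \<le> norm (cnj w2 * z)"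
      by (metis abs_Im_le_cmod abs_mult abs_minus_cancel mult_minus_left)+
    then have "\<bar>of_int n\<bar> * \<bar>D\<bar> \<le> (norm w1 + norm w2) * norm z"
      "\<bar>of_int m\<bar> * \<bar>D\<bar> \<le> (norm w1 + norm w2) * norm z"
      by (auto simp: norm_mult distrib_right intro: add_increasing add_increasing2)
    with D show ?thesis
      unfolding z_def[symmetric] by (simp add: M_def field_simps)
  qed
  \<comment> \<open>At a nonzero lattice point some coordinate has absolute value at least 1, so
    \<open>M\<close> times the norm is at least 1. The summand 1 therefore costs only a doubling of
    the constant.\<close>
  have "1 + \<bar>real_of_int m\<bar> \<le> 2 * M * norm (of_int m * w1 + of_int n * w2) \<and>
       1 + \<bar>real_of_int n\<bar> \<le> 2 * M * norm (of_int m * w1 + of_int n * w2)"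
    if "of_int m * w1 + of_int n * w2 \<noteq> 0" for m n
  proof -
    have "m \<noteq> 0 \<or> n \<noteq> 0" using that by auto
    then have "1 \<le> \<bar>real_of_int m\<bar> \<or> 1 \<le> \<bar>real_of_int n\<bar>" by linarith
    then show ?thesis
      using bound[of m n] by (elim disjE; intro conjI; linarith)
  qed
  then show ?thesis
    using that[of "2 * M" w1 w2] M L by simp
qed

lemma complex_lattice_zero:
  assumes "complex_lattice \<Lambda>" shows "0 \<in> \<Lambda>"
proof -
  obtain w1 w2 where L: "\<Lambda> = {of_int m * w1 + of_int n * w2 | m n :: int. True}"
    using assms unfolding complex_lattice_def by blast
  show ?thesis unfolding L by (auto intro!: exI[of _ "0::int"])
qed

lemma complex_lattice_diff:
  assumes "complex_lattice \<Lambda>" "v \<in> \<Lambda>" "w \<in> \<Lambda>" shows "v - w \<in> \<Lambda>"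
proof -
  obtain w1 w2 where L: "\<Lambda> = {of_int m * w1 + of_int n * w2 | m n :: int. True}"
    using assms unfolding complex_lattice_def by blast
  obtain m n m' n' where "v = of_int m * w1 + of_int n * w2" "w = of_int m' * w1 + of_int n' * w2"
    using assms unfolding L by blast
  then have "v - w = of_int (m - m') * w1 + of_int (n - n') * w2"
    by (simp add: algebra_simps)
  then show ?thesis unfolding L by blast
qed

lemma complex_lattice_discrete:
  assumes "complex_lattice \<Lambda>"
  obtains d where "d > 0" "\<And>w. w \<in> \<Lambda> - {0} \<Longrightarrow> d \<le> norm w"
proof -
  obtain w1 w2 K where K: "K > 0" "\<Lambda> = {of_int m * w1 + of_int n * w2 | m n :: int. True}"
    and *: "\<And>m n. of_int m * w1 + of_int n * w2 \<noteq> 0 \<Longrightarrow>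
       1 + \<bar>real_of_int m\<bar> \<le> K * norm (of_int m * w1 + of_int n * w2) \<and>
       1 + \<bar>real_of_int n\<bar> \<le> K * norm (of_int m * w1 + of_int n * w2)"
    by (rule complex_lattice_coordinates[OF assms]) (rule that; blast)
  have "1 / K \<le> norm w" if w: "w \<in> \<Lambda> - {0}" for w
  proof -
    obtain m n where "w = of_int m * w1 + of_int n * w2" using w K(2) by blast
    then have "1 + \<bar>real_of_int m\<bar> \<le> K * norm w" using * w by blast
    then have "1 \<le> K * norm w" by linarith
    then show ?thesis using K(1) by (simp add: field_simps)
  qed
  with K(1) show ?thesis by (intro that[of "1 / K"]) auto
qed

text \<open>Both factors 1 + |m| and 1 + |n| are at most K|w|, so their product is at most (K|w|)^2.
  Raising this to the power -3/2 bounds 1/|w|^3 by a multiple of a summable term.\<close>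

lemma complex_lattice_summable_cube:
  assumes "complex_lattice \<Lambda>"
  shows "(\<lambda>w. 1 / norm w ^ 3) summable_on (\<Lambda> - {0})"
proof -
  obtain w1 w2 K where K: "K > 0" "\<Lambda> = {of_int m * w1 + of_int n * w2 | m n :: int. True}"
    and *: "\<And>m n. of_int m * w1 + of_int n * w2 \<noteq> 0 \<Longrightarrow>
       1 + \<bar>real_of_int m\<bar> \<le> K * norm (of_int m * w1 + of_int n * w2) \<and>
       1 + \<bar>real_of_int n\<bar> \<le> K * norm (of_int m * w1 + of_int n * w2)"
    by (rule complex_lattice_coordinates[OF assms]) (rule that; blast)
  define g where "g = (\<lambda>(m::int, n::int). of_int m * w1 + of_int n * w2)"
  define F where "F = (\<lambda>(m::int, n::int). ((1 + \<bar>real_of_int m\<bar>) * (1 + \<bar>real_of_int n\<bar>)) powr (-3/2))"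
  \<comment> \<open>A chosen preimage under \<open>g\<close> is automatically injective on the
    lattice, so uniqueness of coordinates need not be shown.\<close>
  define p where "p = inv_into UNIV g"
  have range: "\<Lambda> = range g"
    by (auto simp: K(2) g_def)
  have "inj_on p (\<Lambda> - {0})"
    unfolding p_def range by (rule inj_on_subset[OF inj_on_inv_into]) auto
  moreover have "F summable_on (p ` (\<Lambda> - {0}))"
    using summable_on_int_pair_powr unfolding F_def by (rule summable_on_subset) auto
  ultimately have "(F \<circ> p) summable_on (\<Lambda> - {0})"
    by (simp add: summable_on_reindex)
  then have sum: "(\<lambda>w. K ^ 3 * F (p w)) summable_on (\<Lambda> - {0})"
    by (intro summable_on_cmult_right) (simp add: o_def)
  show ?thesis
  proof (rule summable_on_comparison_test[OF sum])
    fix w assume w: "w \<in> \<Lambda> - {0}"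
    obtain m n where p: "p w = (m, n)" by fastforce
    have "g (p w) = w"
      using w unfolding p_def range by (auto intro: f_inv_into_f)
    then have mn: "w = of_int m * w1 + of_int n * w2"
      by (simp add: p g_def)
    define q where "q = (1 + \<bar>real_of_int m\<bar>) * (1 + \<bar>real_of_int n\<bar>)"
    have q0: "q > 0" by (simp add: q_def add_pos_nonneg)
    have "q \<le> (K * norm w) * (K * norm w)"
      unfolding q_def using *[of m n] w mn by (intro mult_mono) auto
    then have "((K * norm w) * (K * norm w)) powr (-3/2) \<le> q powr (-3/2)"
      using q0 by (intro powr_mono2') auto
    also have "((K * norm w) * (K * norm w)) powr (-3/2) = ((K * norm w) powr 2) powr (-3/2)"
      using K(1) by (simp add: powr_numeral power2_eq_square)
    also have "\<dots> = (K * norm w) powr (-3)"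
      by (simp only: powr_powr) simp
    also have "\<dots> = 1 / (K * norm w) ^ 3"
      using K(1) w by (simp add: powr_minus powr_numeral divide_inverse)
    finally have "1 / (K * norm w) ^ 3 \<le> F (p w)"
      by (simp add: p F_def q_def)
    then show "1 / norm w ^ 3 \<le> K ^ 3 * F (p w)"
      using K(1) w by (simp add: power_mult_distrib field_simps)
  qed auto
qed

section \<open>The second difference of the Weierstrass function\<close>

text \<open>The terms are O(1/|w|^3), which gives absolute convergence. Since 1/0 = 0, the term at w
  = 0 is exactly the leading 1/z^2, so the sum can run over the whole lattice, an index set stable
  under reflections.\<close>

lemma weierstrass_p_has_sum:
  assumes \<Lambda>: "complex_lattice \<Lambda>" and z: "z \<notin> \<Lambda>"
    and d: "d > 0" "\<And>w. w \<in> \<Lambda> - {0} \<Longrightarrow> d \<le> norm w" "\<And>w. w \<in> \<Lambda> \<Longrightarrow> d \<le> norm (z - w)"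
  shows "((\<lambda>w. 1 / (z - w)\<^sup>2 - 1 / w\<^sup>2) has_sum weierstrass_p \<Lambda> z) \<Lambda>"
proof -
  let ?t = "\<lambda>w. 1 / (z - w)\<^sup>2 - 1 / w\<^sup>2"
  \<comment> \<open>From |z| \<le> (|z|/d) |z - w| follows |w| \<le> M |z - w|, and from |z| \<le>
    (|z|/d) |w| follows |2w - z| \<le> (2 + |z|/d) |w|. Together they produce
    \<open>C\<close>.\<close>
  define M where "M = 1 + norm z / d"
  have M: "M > 0" using d(1) by (simp add: M_def add_pos_nonneg)
  define C where "C = norm z * (2 + norm z / d) * M\<^sup>2"
  have "norm (?t w) \<le> C * (1 / norm w ^ 3)" if w: "w \<in> \<Lambda> - {0}" for w
  proof -
    have zw: "z - w \<noteq> 0" using z w by auto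
    have "?t w = z * (2 * w - z) / (w\<^sup>2 * (z - w)\<^sup>2)"
    proof -
      have "?t w = (w\<^sup>2 - (z - w)\<^sup>2) / (w\<^sup>2 * (z - w)\<^sup>2)"
        using zw w by (simp add: diff_frac_eq mult.commute)
      also have "w\<^sup>2 - (z - w)\<^sup>2 = z * (2 * w - z)"
        by (simp add: power2_eq_square algebra_simps)
      finally show ?thesis .
    qed
    then have eq: "norm (?t w) = norm z * norm (2 * w - z) / (norm w ^ 2 * norm (z - w) ^ 2)"
      by (simp add: norm_divide norm_mult norm_power)
    have "norm z \<le> norm z / d * norm w" "norm z \<le> norm z / d * norm (z - w)"
      using mult_left_mono[OF d(2)[OF w], of "norm z / d"] mult_left_mono[OF d(3)[of w], of "norm z / d"] d(1) w
      by auto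
    moreover have "norm (2 * w - z) \<le> 2 * norm w + norm z"
      by (metis norm_triangle_ineq4 norm_mult norm_numeral)
    moreover have "norm w \<le> norm (z - w) + norm z"
      by (metis norm_minus_commute norm_triangle_sub add.commute)
    ultimately have b: "norm (2 * w - z) \<le> (2 + norm z / d) * norm w" "norm w \<le> M * norm (z - w)"
      by (auto simp: M_def algebra_simps)
    have "norm (?t w) * norm w ^ 4 = norm z * norm (2 * w - z) * norm w ^ 2 / norm (z - w) ^ 2"
      using w zw unfolding eq by (simp add: field_simps power2_eq_square power4_eq_xxxx)
    also have "\<dots> \<le> norm z * ((2 + norm z / d) * norm w) * (M * norm (z - w)) ^ 2 / norm (z - w) ^ 2"
      using b d(1) by (intro divide_right_mono mult_mono power_mono) auto
    also have "\<dots> = C * norm w"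
      using zw by (simp add: C_def power_mult_distrib)
    finally show ?thesis
      using w by (simp add: field_simps power4_eq_xxxx power3_eq_cube)
  qed
  then have "(\<lambda>w. norm (?t w)) summable_on (\<Lambda> - {0})"
    by (rule Infinite_Sum.abs_summable_on_comparison_test'[OF summable_on_cmult_right[OF complex_lattice_summable_cube[OF \<Lambda>]]])
  then have "(?t has_sum infsum ?t (\<Lambda> - {0})) (\<Lambda> - {0})"
    by (rule has_sum_infsum[OF abs_summable_summable])
  then have "(?t has_sum (?t 0 + infsum ?t (\<Lambda> - {0}))) (insert 0 (\<Lambda> - {0}))"
    by (intro has_sum_insert) auto
  then show ?thesis
    using complex_lattice_zero[OF \<Lambda>] by (simp add: weierstrass_p_def insert_absorb)
qed

lemma has_sum_diff:
  fixes f g :: "'a \<Rightarrow> 'b::topological_ab_group_add"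
  assumes "(f has_sum S) X" "(g has_sum T) X"
  shows "((\<lambda>x. f x - g x) has_sum (S - T)) X"
  using has_sum_add[OF assms(1), of "\<lambda>x. - g x" "- T"] assms(2) by (simp add: has_sum_uminus)

text \<open>Termwise, \<open>w \<mapsto> v - w\<close> turns the sum for \<open>v - z\<close> into the one for \<open>z\<close> up to the
  terms \<open>1 / (v - w)\<^sup>2 - 1 / w\<^sup>2\<close>, whose sum is negated by the same substitution.\<close>

lemma weierstrass_p_reflect:
  assumes \<Lambda>: "complex_lattice \<Lambda>" and v: "v \<in> \<Lambda>"
    and sums: "((\<lambda>w. 1 / (z - w)\<^sup>2 - 1 / w\<^sup>2) has_sum weierstrass_p \<Lambda> z) \<Lambda>"
      "((\<lambda>w. 1 / (v - z - w)\<^sup>2 - 1 / w\<^sup>2) has_sum weierstrass_p \<Lambda> (v - z)) \<Lambda>"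
  shows "weierstrass_p \<Lambda> (v - z) = weierstrass_p \<Lambda> z"
proof -
  define S where "S = weierstrass_p \<Lambda> (v - z) - weierstrass_p \<Lambda> z"
  have bij: "bij_betw (\<lambda>w. v - w) \<Lambda> \<Lambda>"
    by (rule bij_betwI[of _ _ _ "\<lambda>w. v - w"]) (auto intro: complex_lattice_diff[OF \<Lambda> v])
  have "((\<lambda>w. 1 / (z - (v - w))\<^sup>2 - 1 / (v - w)\<^sup>2) has_sum weierstrass_p \<Lambda> z) \<Lambda>"
    using sums(1) by (subst has_sum_reindex_bij_betw[OF bij])
  from has_sum_diff[OF sums(2) this]
  have "((\<lambda>w. 1 / (v - z - w)\<^sup>2 - 1 / w\<^sup>2 - (1 / (z - (v - w))\<^sup>2 - 1 / (v - w)\<^sup>2)) has_sum S) \<Lambda>"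
    by (simp only: S_def)
  moreover have "(v - z - w)\<^sup>2 = (z - (v - w))\<^sup>2" for w
    by (simp add: power2_eq_square algebra_simps)
  ultimately have *: "((\<lambda>w. 1 / (v - w)\<^sup>2 - 1 / w\<^sup>2) has_sum S) \<Lambda>"
    by simp
  then have "((\<lambda>w. 1 / (v - (v - w))\<^sup>2 - 1 / (v - w)\<^sup>2) has_sum S) \<Lambda>"
    by (subst has_sum_reindex_bij_betw[OF bij])
  from this have "((\<lambda>w. 1 / (v - w)\<^sup>2 - 1 / w\<^sup>2) has_sum - S) \<Lambda>"
    by (subst has_sum_uminus[symmetric]) simp
  with * have "S = - S" by (rule has_sum_unique)
  then show ?thesis by (simp add: S_def)
qed

text \<open>Over a common denominator the expression equals h^2 (6u^2 - 2h^2) / (u^2 (u^2 - h^2)^2),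
  and |h| \<le> |u|/2 keeps |u^2 - h^2| above 3/4 |u|^2.\<close>

lemma second_difference_bound:
  fixes u h :: complex
  assumes "u \<noteq> 0" "2 * norm h \<le> norm u"
  shows "norm (1 / (u + h)\<^sup>2 + 1 / (u - h)\<^sup>2 - 2 / u\<^sup>2) \<le> 24 * (norm h)\<^sup>2 / norm u ^ 4"
proof -
  have nh: "norm h \<le> norm u / 2" using assms by simp
  have hu: "norm (h\<^sup>2) \<le> (norm u)\<^sup>2 / 4"
    using power_mono[OF nh, of 2] by (simp add: norm_power power_divide)
  have a: "norm (u\<^sup>2 - h\<^sup>2) \<ge> (norm u)\<^sup>2 * (3/4)"
    using norm_triangle_ineq2[of "u\<^sup>2" "h\<^sup>2"] hu by (simp add: norm_power)
  then have ne: "u\<^sup>2 - h\<^sup>2 \<noteq> 0" using assms(1)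
    by (smt (verit) norm_zero zero_less_norm_iff zero_less_power mult_pos_pos divide_pos_pos)
  then have ne2: "u + h \<noteq> 0" "u - h \<noteq> 0"
    by (auto simp: power2_eq_square add_eq_0_iff)
  have "1 / (u + h)\<^sup>2 + 1 / (u - h)\<^sup>2 - 2 / u\<^sup>2
      = ((u - h)\<^sup>2 * u\<^sup>2 + (u + h)\<^sup>2 * u\<^sup>2 - 2 * ((u + h)\<^sup>2 * (u - h)\<^sup>2)) / (u\<^sup>2 * ((u + h)\<^sup>2 * (u - h)\<^sup>2))"
    using ne2 assms(1) by (simp add: divide_simps) (simp add: algebra_simps)
  also have "(u + h)\<^sup>2 * (u - h)\<^sup>2 = (u\<^sup>2 - h\<^sup>2)\<^sup>2"
    by (simp add: power2_eq_square algebra_simps)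
  also have "(u - h)\<^sup>2 * u\<^sup>2 + (u + h)\<^sup>2 * u\<^sup>2 - 2 * (u\<^sup>2 - h\<^sup>2)\<^sup>2 = h\<^sup>2 * (6 * u\<^sup>2 - 2 * h\<^sup>2)"
    by (simp add: power2_eq_square algebra_simps)
  finally have "norm (1 / (u + h)\<^sup>2 + 1 / (u - h)\<^sup>2 - 2 / u\<^sup>2)
      = (norm h)\<^sup>2 * norm (6 * u\<^sup>2 - 2 * h\<^sup>2) / ((norm u)\<^sup>2 * (norm (u\<^sup>2 - h\<^sup>2))\<^sup>2)"
    by (simp add: norm_mult norm_divide norm_power)
  \<comment> \<open>Here 13/2 = 6 + 2/4 bounds the numerator, and dividing by (3/4)^2 gives 104/9,
    which is below 24.\<close>
  also have "\<dots> \<le> (norm h)\<^sup>2 * (13/2 * (norm u)\<^sup>2) / ((norm u)\<^sup>2 * ((norm u)\<^sup>2 * (3/4))\<^sup>2)"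
  proof (intro frac_le mult_left_mono power_mono)
    show "norm (6 * u\<^sup>2 - 2 * h\<^sup>2) \<le> 13/2 * (norm u)\<^sup>2"
      using norm_triangle_ineq4[of "6 * u\<^sup>2" "2 * h\<^sup>2"] hu by (simp add: norm_mult norm_power)
  qed (use assms a in auto)
  also have "\<dots> = 104/9 * (norm h)\<^sup>2 / norm u ^ 4"
    using assms(1) by (simp add: field_simps power2_eq_square power4_eq_xxxx)
  also have "\<dots> \<le> 24 * (norm h)\<^sup>2 / norm u ^ 4"
    by (intro divide_right_mono mult_right_mono) auto
  finally show ?thesis .
qed

text \<open>Reflection in the half-period \<open>c\<close> makes the values at c + h and c - h
  equal, so twice the increment is a second difference. Termwise the parts 1/w^2 cancel and
  \<open>second_difference_bound\<close> applies with u = c - w.\<close>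

lemma weierstrass_p_half_period:
  assumes \<Lambda>: "complex_lattice \<Lambda>" and c: "2 * c \<in> \<Lambda>" "c \<notin> \<Lambda>"
  obtains C r where "C > 0" "r > 0"
    "\<And>h. norm h \<le> r \<Longrightarrow> norm (weierstrass_p \<Lambda> (c + h) - weierstrass_p \<Lambda> c) \<le> C * (norm h)\<^sup>2"
proof -
  obtain d where d: "d > 0" "\<And>w. w \<in> \<Lambda> - {0} \<Longrightarrow> d \<le> norm w"
    by (rule complex_lattice_discrete[OF \<Lambda>]) (rule that; blast)
  \<comment> \<open>Doubling moves the shifted lattice c - \<Lambda> into the nonzero lattice
    points. This yields both the distance d/2 from \<open>c\<close> to the lattice and summability
    over the shifted lattice.\<close>
  have mem: "2 * (c - w) \<in> \<Lambda> - {0}" if "w \<in> \<Lambda>" for w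
  proof -
    have "2 * c - w - w \<in> \<Lambda>"
      using complex_lattice_diff[OF \<Lambda>] c(1) that by blast
    moreover have "c \<noteq> w" using that c(2) by blast
    ultimately show ?thesis by (simp add: algebra_simps)
  qed
  have far: "d / 2 \<le> norm (c - w)" if "w \<in> \<Lambda>" for w
    using d(2)[OF mem[OF that]] by (simp only: norm_mult) simp
  have sums: "((\<lambda>w. 1 / (c + h - w)\<^sup>2 - 1 / w\<^sup>2) has_sum weierstrass_p \<Lambda> (c + h)) \<Lambda>"
    if "norm h \<le> d / 4" for h
  proof -
    have *: "d / 4 \<le> norm (c + h - w)" if "w \<in> \<Lambda>" for w
      using far[OF that] \<open>norm h \<le> d / 4\<close> norm_triangle_ineq2[of "c - w" "- h"]
      by (simp add: algebra_simps)
    show ?thesis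
    proof (rule weierstrass_p_has_sum[OF \<Lambda>, where d = "d / 4"])
      show "c + h \<notin> \<Lambda>"
        using *[of "c + h"] d(1) by auto
      show "d / 4 \<le> norm w" if "w \<in> \<Lambda> - {0}" for w
        using d(1) d(2)[OF that] by linarith
    qed (use d(1) * in auto)
  qed
  have even: "weierstrass_p \<Lambda> (c - h) = weierstrass_p \<Lambda> (c + h)" if "norm h \<le> d / 4" for h
    using weierstrass_p_reflect[OF \<Lambda> c(1) sums[OF that]] sums[of "- h"] that
    by (simp add: algebra_simps)
  let ?g = "\<lambda>w. 1 / norm (2 * (c - w)) ^ 3"
  have "inj_on (\<lambda>w. 2 * (c - w)) \<Lambda>"
    by (auto simp: inj_on_def)
  moreover have "(\<lambda>w. 1 / norm w ^ 3) summable_on ((\<lambda>w. 2 * (c - w)) ` \<Lambda>)"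
    using complex_lattice_summable_cube[OF \<Lambda>] by (rule summable_on_subset) (use mem in auto)
  ultimately have g: "?g summable_on \<Lambda>"
    by (simp add: summable_on_reindex o_def)
  \<comment> \<open>The factor 24 of the second difference, 2^3 from doubling u and 2/d from 1/|u|
    multiply to 384/d; passing from the second difference to the increment halves it. The 1 ensures
    positivity.\<close>
  define C where "C = 192 / d * infsum ?g \<Lambda> + 1"
  have C0: "infsum ?g \<Lambda> \<ge> 0"
    by (rule infsum_nonneg) auto
  then have C: "C > 0"
    using d(1) by (simp add: C_def add_nonneg_pos)
  have "norm (weierstrass_p \<Lambda> (c + h) - weierstrass_p \<Lambda> c) \<le> C * (norm h)\<^sup>2" if h: "norm h \<le> d / 4" for h
  proof -
    have pm: "((\<lambda>w. (1 / (c + h - w)\<^sup>2 - 1 / w\<^sup>2) + (1 / (c + - h - w)\<^sup>2 - 1 / w\<^sup>2))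
        has_sum (weierstrass_p \<Lambda> (c + h) + weierstrass_p \<Lambda> (c + - h))) \<Lambda>"
      using h by (intro has_sum_add sums) auto
    have z: "((\<lambda>w. 2 * (1 / (c + 0 - w)\<^sup>2 - 1 / w\<^sup>2)) has_sum (2 * weierstrass_p \<Lambda> (c + 0))) \<Lambda>"
      using d(1) by (intro has_sum_cmult_right sums) auto
    have "norm (weierstrass_p \<Lambda> (c + h) + weierstrass_p \<Lambda> (c + - h) - 2 * weierstrass_p \<Lambda> (c + 0))
        \<le> 384 / d * (norm h)\<^sup>2 * infsum ?g \<Lambda>"
    proof (rule norm_infsum_le[OF has_sum_diff[OF pm z] has_sum_cmult_right[OF has_sum_infsum[OF g]]])
      fix w assume w: "w \<in> \<Lambda>"
      define u where "u = c - w"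
      have u: "d / 2 \<le> norm u" "u \<noteq> 0" using far[OF w] d(1) by (auto simp: u_def)
      have "1 / (c + h - w)\<^sup>2 - 1 / w\<^sup>2 + (1 / (c + - h - w)\<^sup>2 - 1 / w\<^sup>2) - 2 * (1 / (c + 0 - w)\<^sup>2 - 1 / w\<^sup>2)
          = 1 / (u + h)\<^sup>2 + 1 / (u - h)\<^sup>2 - 2 / u\<^sup>2"
        by (simp add: u_def algebra_simps)
      also have "norm \<dots> \<le> 24 * (norm h)\<^sup>2 / norm u ^ 4"
        using u h by (intro second_difference_bound) auto
      also have "\<dots> = 24 * (norm h)\<^sup>2 / norm u ^ 3 * (1 / norm u)"
        by (simp add: power3_eq_cube power4_eq_xxxx)
      also have "\<dots> \<le> 24 * (norm h)\<^sup>2 / norm u ^ 3 * (2 / d)"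
        using u d(1) by (intro mult_left_mono) (auto simp: field_simps)
      also have "\<dots> = 384 / d * (norm h)\<^sup>2 * (1 / norm (2 * (c - w)) ^ 3)"
        by (simp add: norm_mult power_mult_distrib u_def[symmetric])
      finally show "norm (1 / (c + h - w)\<^sup>2 - 1 / w\<^sup>2 + (1 / (c + - h - w)\<^sup>2 - 1 / w\<^sup>2)
          - 2 * (1 / (c + 0 - w)\<^sup>2 - 1 / w\<^sup>2)) \<le> 384 / d * (norm h)\<^sup>2 * (1 / norm (2 * (c - w)) ^ 3)" .
    qed
    moreover have "weierstrass_p \<Lambda> (c + h) + weierstrass_p \<Lambda> (c + - h) - 2 * weierstrass_p \<Lambda> (c + 0)
        = 2 * (weierstrass_p \<Lambda> (c + h) - weierstrass_p \<Lambda> c)"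
      using even[OF h] by (simp add: algebra_simps)
    ultimately have "2 * norm (weierstrass_p \<Lambda> (c + h) - weierstrass_p \<Lambda> c)
        \<le> 384 / d * (norm h)\<^sup>2 * infsum ?g \<Lambda>"
      by (simp only: norm_mult norm_numeral)
    also have "\<dots> \<le> 2 * (C * (norm h)\<^sup>2)"
      by (simp add: C_def algebra_simps)
    finally show ?thesis by simp
  qed
  with C d(1) show ?thesis by (intro that[of C "d / 4"]) auto
qed

section \<open>Equidistribution\<close>

text \<open>The second interval accounts for arguments to the left of \<open>a\<close>, whose fractional parts
  are near \<open>1\<close> when \<open>a\<close> is an integer.\<close>

lemma frac_near:
  fixes a :: real
  obtains f g r where "0 \<le> f" "f < 1" "0 < g" "g \<le> 1" "r > 0" "f + r \<le> 1" "0 \<le> g - r"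
    "\<And>t \<delta>. \<bar>t - a\<bar> \<le> \<delta> \<Longrightarrow> \<delta> < r \<Longrightarrow> frac t \<in> {f..f + \<delta>} \<union> {g - \<delta>..g}"
proof -
  define f where "f = frac a"
  define g where "g = (if f = 0 then 1 else f)"
  \<comment> \<open>The bound 1 - f stops arguments right of \<open>a\<close> before the next
    integer; the bound \<open>g\<close> stops those on the left before the integer a - g.\<close>
  define r where "r = min (1 - f) g"
  have f: "0 \<le> f" "f < 1" by (auto simp: f_def frac_ge_0 frac_lt_1)
  have a: "a = of_int \<lfloor>a\<rfloor> + f" by (simp add: f_def frac_def)
  have "frac t \<in> {f..f + \<delta>} \<union> {g - \<delta>..g}" if t: "\<bar>t - a\<bar> \<le> \<delta>" "\<delta> < r" for t \<delta>
  proof (cases "t \<ge> a")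
    case True
    have "frac t = t - of_int \<lfloor>a\<rfloor>"
      using True a t f by (subst frac_unique_iff) (auto simp: r_def)
    then show ?thesis using True a t by auto
  next
    case False
    have "t - (a - g) \<ge> 0" "t - (a - g) < g" "g \<le> 1" "a - g \<in> \<int>"
      using False t f a by (auto simp: r_def g_def) (metis Ints_of_int add_diff_cancel_right')+
    then have "frac t = t - (a - g)"
      by (subst frac_unique_iff) auto
    then show ?thesis using False t by auto
  qed
  then show ?thesis
    using f by (intro that[of f g r]) (auto simp: r_def g_def)
qed

text \<open>The counts satisfy the inequality for every N, and it survives in the limit. The two
  target intervals may overlap, since only subadditivity of cardinality enters.\<close>

lemma equidistributed_in_le:
  assumes s: "equidistributed_in s a b" "a \<le> c" "c \<le> d" "d \<le> b"
    and t: "equidistributed_in t a' b'"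
      "a' \<le> c1" "c1 \<le> d1" "d1 \<le> b'" "a' \<le> c2" "c2 \<le> d2" "d2 \<le> b'"
    and imp: "\<And>n. n \<ge> 1 \<Longrightarrow> s n \<in> {c..d} \<Longrightarrow> t n \<in> {c1..d1} \<union> {c2..d2}"
  shows "(d - c) / (b - a) \<le> (d1 - c1) / (b' - a') + (d2 - c2) / (b' - a')"
proof (rule LIMSEQ_le)
  let ?card = "\<lambda>u c d N. real (card {n \<in> {1..N}. u n \<in> {c..d}}) / real N"
  show "?card s c d \<longlonglongrightarrow> (d - c) / (b - a)"
    using s unfolding equidistributed_in_def by blast
  have "?card t c1 d1 \<longlonglongrightarrow> (d1 - c1) / (b' - a')" "?card t c2 d2 \<longlonglongrightarrow> (d2 - c2) / (b' - a')"
    using t unfolding equidistributed_in_def by blast+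
  then show "(\<lambda>N. ?card t c1 d1 N + ?card t c2 d2 N)
      \<longlonglongrightarrow> (d1 - c1) / (b' - a') + (d2 - c2) / (b' - a')"
    by (rule tendsto_add)
  have "?card s c d N \<le> ?card t c1 d1 N + ?card t c2 d2 N" for N
  proof -
    have "card {n \<in> {1..N}. s n \<in> {c..d}}
        \<le> card ({n \<in> {1..N}. t n \<in> {c1..d1}} \<union> {n \<in> {1..N}. t n \<in> {c2..d2}})"
      using imp by (intro card_mono) auto
    also have "\<dots> \<le> card {n \<in> {1..N}. t n \<in> {c1..d1}} + card {n \<in> {1..N}. t n \<in> {c2..d2}}"
      by (rule card_Un_le)
    finally show ?thesis
      by (simp add: divide_right_mono flip: add_divide_distrib of_nat_add)
  qed
  then show "\<exists>N. \<forall>n\<ge>N. ?card s c d n \<le> ?card t c1 d1 n + ?card t c2 d2 n"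
    by blast
qed

theorem theorem21:
  fixes A B \<omega> :: real and \<Lambda> :: "complex set" and x y s :: "nat \<Rightarrow> real"
  assumes "4 * A ^ 3 + 27 * B ^ 2 \<noteq> 0"
    and "complex_lattice \<Lambda>"
    and "lattice_g2 \<Lambda> = complex_of_real (- 4 * A)"
    and "lattice_g3 \<Lambda> = complex_of_real (- 4 * B)"
    and "least_positive_real_period \<Lambda> \<omega>"
    and "\<And>n. n \<ge> 1 \<Longrightarrow> (x n, y n) \<in> affine_identity_component A B"
    and "\<And>n. n \<ge> 1 \<Longrightarrow> uniformization_parameter \<Lambda> \<omega> (x n, y n) (s n)"
    and "equidistributed_in s 0 \<omega>"
  shows "\<not> equidistributed_in (\<lambda>n. frac (x n)) 0 1"
proof
  assume frac: "equidistributed_in (\<lambda>n. frac (x n)) 0 1"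
  have \<omega>: "\<omega> > 0" "complex_of_real \<omega> \<in> \<Lambda>" "\<And>t. 0 < t \<Longrightarrow> complex_of_real t \<in> \<Lambda> \<Longrightarrow> \<omega> \<le> t"
    using assms(5) unfolding least_positive_real_period_def by auto
  define c where "c = complex_of_real (\<omega> / 2)"
  \<comment> \<open>If \<omega>/2 were in the lattice, it would be a positive real period smaller
    than \<omega>.\<close>
  have c: "2 * c \<in> \<Lambda>" "c \<notin> \<Lambda>"
    using \<omega>(1,2) \<omega>(3)[of "\<omega> / 2"] by (auto simp: c_def)
  obtain C r where C: "C > 0" "r > 0"
    "\<And>h. norm h \<le> r \<Longrightarrow> norm (weierstrass_p \<Lambda> (c + h) - weierstrass_p \<Lambda> c) \<le> C * (norm h)\<^sup>2"
    by (rule weierstrass_p_half_period[OF assms(2) c]) (rule that; blast)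
  define e where "e = Re (weierstrass_p \<Lambda> c)"
  obtain f g q where q: "0 \<le> f" "f < 1" "0 < g" "g \<le> 1" "q > 0" "f + q \<le> 1" "0 \<le> g - q"
    "\<And>t \<delta>. \<bar>t - e\<bar> \<le> \<delta> \<Longrightarrow> \<delta> < q \<Longrightarrow> frac t \<in> {f..f + \<delta>} \<union> {g - \<delta>..g}"
    by (rule frac_near[of e]) (rule that; blast)
  \<comment> \<open>The bound \<open>r\<close> admits the quadratic estimate, \<omega>/2 keeps the
    window inside [0, \<omega>], 1 and q/(2C) together force C h^2 < q, and 1/(2C\<omega>) gives the
    final contradiction.\<close>
  define h where "h = min (min r (\<omega> / 2)) (min (1 / (2 * C * \<omega>)) (min 1 (q / (2 * C))))"
  define \<delta> where "\<delta> = C * h\<^sup>2"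
  have h: "h > 0" "h \<le> r" "h \<le> \<omega> / 2" "h \<le> 1" "h \<le> 1 / (2 * C * \<omega>)" "h \<le> q / (2 * C)"
    using \<omega>(1) C(1,2) q(5) by (auto simp: h_def)
  have "C * (h * h) \<le> C * h"
    using h C(1) by (intro mult_left_mono mult_left_le) auto
  moreover have "C * h < q"
    using h(6) C(1) q(5) by (simp add: field_simps)
  ultimately have "C * (h * h) < q"
    by linarith
  then have \<delta>: "0 \<le> \<delta>" "\<delta> < q"
    using C(1) by (auto simp: \<delta>_def power2_eq_square)
  have near: "frac (x n) \<in> {f..f + \<delta>} \<union> {g - \<delta>..g}"
    if n: "n \<ge> 1" and s: "s n \<in> {\<omega> / 2 - h..\<omega> / 2 + h}" for n
  proof (rule q(8))
    define k where "k = s n - \<omega> / 2"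
    have k: "\<bar>k\<bar> \<le> h" using s by (auto simp: k_def)
    have "complex_of_real (x n) = weierstrass_p \<Lambda> (c + of_real k)"
      using assms(7)[OF n] by (simp add: uniformization_parameter_def c_def k_def)
    then have "x n - e = Re (weierstrass_p \<Lambda> (c + of_real k) - weierstrass_p \<Lambda> c)"
      by (metis Re_complex_of_real e_def minus_complex.simps(1))
    then have "\<bar>x n - e\<bar> \<le> norm (weierstrass_p \<Lambda> (c + of_real k) - weierstrass_p \<Lambda> c)"
      by (simp only: abs_Re_le_cmod)
    also have "\<dots> \<le> C * \<bar>k\<bar>\<^sup>2"
      using C(3)[of "of_real k"] k h(2) by simp
    also have "\<dots> \<le> \<delta>"
      unfolding \<delta>_def using k C(1) by (intro mult_left_mono power_mono) auto
    finally show "\<bar>x n - e\<bar> \<le> \<delta>" .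
  qed (fact \<delta>(2))
  \<comment> \<open>The window has frequency 2h/\<omega>, the two target intervals together 2C h^2.
    So 1 \<le> C\<omega>h, whereas the choice of \<open>h\<close> gives C\<omega>h \<le>
    1/2.\<close>
  have "(\<omega> / 2 + h - (\<omega> / 2 - h)) / (\<omega> - 0) \<le> (f + \<delta> - f) / (1 - 0) + (g - (g - \<delta>)) / (1 - 0)"
    by (rule equidistributed_in_le[OF assms(8) _ _ _ frac])
      (use h \<delta> q(1-7) near in auto)
  then have "h \<le> C * h\<^sup>2 * \<omega>"
    using \<omega>(1) by (simp add: \<delta>_def field_simps)
  then have "1 \<le> h * (C * \<omega>)"
    using h(1) by (simp add: power2_eq_square mult_ac)
  moreover have "h * (C * \<omega>) > 0" using h(1) C(1) \<omega>(1) by simp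
  ultimately show False
    using h(5) C(1) \<omega>(1) by (simp add: field_simps)
qed

end
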